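(* Let $\alpha,\beta>0$ and $\lambda\in\mathbb{R}$. Then the formula $$\mathcal{L}\left(\frac{\partial}{\partial\alpha}\left[t^{\beta-1}E_{\alpha,\beta}(\lambda t^{\alpha})\right]\right)(s)=\int_0^{\infty}e^{-st}\sum_{k=0}^{\infty}k\lambda^{k}\left[\frac{t^{\alpha k+\beta-1}\left(\ln t-\psi(\alpha k+\beta)\right)}{\Gamma(\alpha k+\beta)}\right]dt=-\frac{\lambda s^{\alpha-\beta}\ln s}{(s^{\alpha}-\lambda)^{2}}$$ is valid for all $s$ with $\mathrm{Re}\,s>0$ and $|\lambda s^{-\alpha}|<1$.
   Context: $E_{\alpha,\beta}(z)=\sum_{k=0}^{\infty}\frac{z^k}{\Gamma(\alpha k+\beta)}$ is the two-parametric Mittag-Leffler function. $\psi(t)=(\ln\Gamma(t))'=\Gamma'(t)/\Gamma(t)$ is the digamma function. The Laplace transform acts in the variable $t>0$: $\mathcal{L}(f(t))(s)=\int_0^\infty e^{-st}f(t)\,dt$. Powers of $s$ and $\ln s$ are principal branches.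
   Formalization: The integral can diverge in the stated region (α=β=1, λ=2, s=1+3i). Proved: convergence and the formula for Re s > |λ|^(1/α); elsewhere in the region the formula holds if the integral converges absolutely (not shown, even for λ<0), and the right side is its analytic continuation. *)

theory Defs
  imports "HOL-Complex_Analysis.Complex_Analysis"
begin

definition mittag_leffler :: "real \<Rightarrow> real \<Rightarrow> real \<Rightarrow> real" where
  "mittag_leffler \<alpha> \<beta> z = (\<Sum>k. z ^ k / Gamma (\<alpha> * real k + \<beta>))"

definition laplace_converges :: "(real \<Rightarrow> real) \<Rightarrow> complex \<Rightarrow> bool" where
  "laplace_converges f s \<longleftrightarrow>
     set_integrable lborel {0<..} (\<lambda>t. exp (- (s * of_real t)) * of_real (f t))"

text \<open>The value is meaningful only where \<^const>\<open>laplace_converges\<close> holds; elsewhere it is the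
  default value 0 of the Lebesgue integral.\<close>

definition laplace :: "(real \<Rightarrow> real) \<Rightarrow> complex \<Rightarrow> complex" where
  "laplace f s = (LINT t:{0<..}|lborel. exp (- (s * of_real t)) * of_real (f t))"

text \<open>The Laplace transform of \<open>f\<close>, as an analytic function on the domain \<open>D\<close>, is \<open>F\<close>: the Laplace
  integral converges in some right half-plane inside \<open>D\<close>, and \<open>F\<close> is holomorphic on all of \<open>D\<close> and
  equals the integral at every point of \<open>D\<close> where the integral converges. Since \<open>D\<close> is open and
  connected, the identity theorem makes \<open>F\<close> unique on \<open>D\<close>.\<close>

definition has_laplace_transform_on ::
    "(real \<Rightarrow> real) \<Rightarrow> (complex \<Rightarrow> complex) \<Rightarrow> complex set \<Rightarrow> bool" where
  "has_laplace_transform_on f F D \<longleftrightarrow>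
     open D \<and> connected D \<and> F holomorphic_on D \<and>
     (\<exists>c. \<forall>s. c < Re s \<longrightarrow> s \<in> D \<and> laplace_converges f s) \<and>
     (\<forall>s\<in>D. laplace_converges f s \<longrightarrow> laplace f s = F s)"

end

theory Submission
  imports Defs
begin

text \<open>
  The function \<open>t powr (\<beta> - 1) * E(l * t powr \<alpha>)\<close> is the sum of \<open>l ^ k\<close> times
  \<open>t powr (z - 1) / Gamma z\<close> at \<open>z = \<alpha> * k + \<beta>\<close>. Differentiating in \<open>\<alpha>\<close> gives each term a factor
  \<open>k\<close> and replaces \<open>t powr (z - 1) / Gamma z\<close> by its derivative in \<open>z\<close>, called \<open>log_kernel z t\<close>
  below. As \<open>t powr (z - 1) / Gamma z\<close> has the Laplace transform \<open>s powr (- z)\<close>, the kernel has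
  the transform \<open>- ln s * s powr (- z)\<close>, and with \<open>q = l * s powr (- \<alpha>)\<close> the series is
  \<open>- ln s * s powr (- \<beta>) * (\<Sum>k. k * q ^ k) = - ln s * s powr (- \<beta>) * q / (1 - q)\<^sup>2\<close>,
  which is the claimed value.

  Two exchanges have to be justified. That of sum and derivative
  (\<open>mittag_leffler_has_parameter_derivative\<close>) rests on the growth of \<open>Gamma\<close>, which beats every
  geometric sequence. That of sum and integral (\<open>log_kernel_series_laplace\<close>) rests
  on a bound for the \<open>L\<^sup>1\<close> norm of the weighted kernel (\<open>log_kernel_L1_bound\<close>) by
  \<open>\<sigma> powr (- z)\<close> times a factor linear in \<open>z\<close>. This covers real
  \<open>s > \<bar>l\<bar> powr (1 / \<alpha>)\<close>, where all integrals are real.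

  All other points are reached by analytic continuation (\<open>laplace_eq_continuation\<close>): a Laplace
  integral that converges absolutely at \<open>s0\<close> is holomorphic to the right of \<open>s0\<close> and continuous up to
  \<open>s0\<close> from the right, the closed form is holomorphic on the right half-plane without a disc, and the
  part of this domain to the right of \<open>s0\<close> is connected. This also settles the points of
  the domain with \<open>Re s \<le> \<bar>l\<bar> powr (1 / \<alpha>)\<close>: wherever the integral converges there, it has
  the same closed form.
\<close>

section \<open>Growth of the Gamma and digamma functions\<close>

text \<open>The Gamma function outgrows every geometric sequence. The piece of Euler's integral over
  \<open>{S..S+1}\<close> already shows it, because there \<open>t powr (z - 1) / exp t\<close> is at least
  \<open>S powr z / t * exp (- t)\<close>.\<close>
lemma Gamma_ge_powr:
  fixes z S :: real
  assumes "z > 0" "S > 0"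
  shows "S powr z * (exp (-(S+1)) / (S+1)) \<le> Gamma z"
proof -
  have "((\<lambda>t. S powr z * (exp (-(S+1)) / (S+1))) has_integral
          (S + 1 - S) *\<^sub>R (S powr z * (exp (-(S+1)) / (S+1)))) {S..S+1}"
    using has_integral_const_real[of "S powr z * (exp (-(S+1)) / (S+1))" S "S+1"] assms by simp
  moreover have "S powr z * (exp (-(S+1)) / (S+1)) \<le> t powr (z - 1) / exp t" if "t \<in> {S..S+1}" for t
  proof -
    have t: "S \<le> t" "t \<le> S+1" "t > 0" using that assms by auto
    have "S powr z * (exp (-(S+1)) / (S+1)) \<le> t powr z * (exp (-t) / t)"
      using t assms by (intro mult_mono frac_le powr_mono2) auto
    also have "\<dots> = t powr (z - 1) / exp t"
      using t by (simp add: powr_diff exp_minus field_simps)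
    finally show ?thesis .
  qed
  ultimately have "(S + 1 - S) *\<^sub>R (S powr z * (exp (-(S+1)) / (S+1))) \<le> Gamma z"
    using assms
    by (intro has_integral_le[where S = "{0..}" and
          f = "\<lambda>t. if t \<in> {S..S+1} then S powr z * (exp (-(S+1)) / (S+1)) else 0",
          OF _ Gamma_integral_real])
       (auto simp del: atLeastAtMost_iff simp: has_integral_restrict)
  thus ?thesis by simp
qed

text \<open>Monotonicity and the recurrence \<open>\<psi>(z + 1) = \<psi>(z) + 1 / z\<close> give linear growth. The true
  order is logarithmic, but any polynomial bound is absorbed by the geometric decay of the terms
  in which it is used.\<close>
lemma Digamma_linear_bound:
  fixes z0 :: real
  assumes "z0 > 0"
  obtains A where "A > 0" "\<And>z. z \<ge> z0 \<Longrightarrow> \<bar>Digamma z\<bar> \<le> A * (1 + z)"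
proof -
  have shift: "Digamma (z0 + real n) \<le> Digamma z0 + real n / z0" for n
  proof (induction n)
    case (Suc n)
    have "Digamma (z0 + real (Suc n)) = Digamma (z0 + real n) + 1 / (z0 + real n)"
      using Digamma_plus1[of "z0 + real n"] assms by (simp add: add_ac)
    also have "1 / (z0 + real n) \<le> 1 / z0" using assms by (intro divide_left_mono) auto
    finally show ?case using Suc by (simp add: field_simps add_divide_distrib)
  qed auto
  define A where "A = \<bar>Digamma z0\<bar> + 1 / z0 "
  show ?thesis
  proof (rule that[of A])
    show "A > 0" using assms unfolding A_def by (intro add_nonneg_pos) auto
    fix z assume z: "z \<ge> z0"
    define n where "n = nat \<lceil>z - z0\<rceil>"
    have n: "z \<le> z0 + real n" "real n \<le> z - z0 + 1" unfolding n_def using z by linarith+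
    have "Digamma z \<le> Digamma (z0 + real n)" using assms z n by (intro Digamma_real_mono) auto
    also have "\<dots> \<le> Digamma z0 + real n * (1 / z0)" using shift[of n] by simp
    also have "\<dots> \<le> \<bar>Digamma z0\<bar> + (1 + z) * (1 / z0)"
      using n assms by (intro add_mono mult_right_mono) auto
    finally have up: "Digamma z \<le> \<bar>Digamma z0\<bar> + (1 + z) * (1 / z0)" .
    have lo: "Digamma z \<ge> -\<bar>Digamma z0\<bar>"
      using Digamma_real_mono[OF assms z] by linarith
    have "\<bar>Digamma z0\<bar> * 1 \<le> \<bar>Digamma z0\<bar> * (1 + z)" using z assms by (intro mult_left_mono) auto
    moreover have "0 \<le> (1 + z) * (1 / z0)" using z assms by simp
    moreover have "A * (1 + z) = \<bar>Digamma z0\<bar> * (1 + z) + (1 + z) * (1 / z0)"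
      by (simp add: A_def ring_distribs add_divide_distrib)
    ultimately show "\<bar>Digamma z\<bar> \<le> A * (1 + z)"
      using up lo by linarith
  qed
qed

section \<open>The Laplace transform of powers and logarithms on the real axis\<close>

abbreviation positive_reals :: "real measure" where
  "positive_reals \<equiv> restrict_space lborel {0<..}"

lemma Gamma_integral_scaled:
  fixes z \<sigma> :: real
  assumes "z > 0" "\<sigma> > 0"
  shows "integrable positive_reals (\<lambda>t. t powr (z - 1) * exp (- (\<sigma> * t)))"
    and "(LINT t|positive_reals. t powr (z - 1) * exp (- (\<sigma> * t))) = Gamma z / \<sigma> powr z"
proof -
  let ?g = "\<lambda>t::real. indicator {0<..} t *\<^sub>R (t powr (z - 1) / exp t)"
  have "(\<integral>\<^sup>+t. ennreal (?g t) \<partial>lborel) = ennreal (Gamma z)"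
    unfolding Gamma_conv_nn_integral_real[OF assms(1)]
    by (intro nn_integral_cong) (auto simp: indicator_def)
  hence "has_bochner_integral lborel ?g (Gamma z)"
    using assms by (intro has_bochner_integral_nn_integral) (auto simp: Gamma_real_pos less_imp_le)
  hence "has_bochner_integral lborel (\<lambda>t. ?g (\<sigma> * t)) (Gamma z / \<sigma>)"
    using lborel_has_bochner_integral_real_affine_iff[of \<sigma> ?g "Gamma z" 0] assms
    by (simp add: field_simps)
  hence "has_bochner_integral lborel (\<lambda>t. \<sigma> powr (1 - z) * ?g (\<sigma> * t)) (\<sigma> powr (1 - z) * (Gamma z / \<sigma>))"
    by (rule has_bochner_integral_mult_right)
  also have "(\<lambda>t. \<sigma> powr (1 - z) * ?g (\<sigma> * t)) = (\<lambda>t. indicator {0<..} t *\<^sub>R (t powr (z - 1) * exp (- (\<sigma> * t))))"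
    using assms by (auto simp: fun_eq_iff indicator_def powr_mult exp_minus zero_less_mult_iff
         powr_diff field_simps)
  also have "\<sigma> powr (1 - z) * (Gamma z / \<sigma>) = Gamma z / \<sigma> powr z"
    using assms by (simp add: powr_diff)
  finally have *: "has_bochner_integral lborel (\<lambda>t. indicator {0<..} t *\<^sub>R (t powr (z - 1) * exp (- (\<sigma> * t))))
      (Gamma z / \<sigma> powr z)" .
  show "integrable positive_reals (\<lambda>t. t powr (z - 1) * exp (- (\<sigma> * t)))"
    using * by (subst integrable_restrict_space) (auto simp: has_bochner_integral_iff)
  show "(LINT t|positive_reals. t powr (z - 1) * exp (- (\<sigma> * t))) = Gamma z / \<sigma> powr z"
    using * by (subst integral_restrict_space) (auto simp: has_bochner_integral_iff)
qed

lemma abs_exp_minus_1_le: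
  fixes y :: real
  shows "\<bar>exp y - 1\<bar> \<le> \<bar>y\<bar> * exp \<bar>y\<bar>"
proof (cases "y \<ge> 0")
  case True
  have "(1 + - y) * exp y \<le> exp (- y) * exp y"
    by (intro mult_right_mono exp_ge_add_one_self) auto
  thus ?thesis using True by (simp add: algebra_simps flip: exp_add)
next
  case False
  have "1 - exp y \<le> - y * 1" using exp_ge_add_one_self[of y] by linarith
  also have "\<dots> \<le> - y * exp (- y)" using False by (intro mult_left_mono) auto
  finally show ?thesis using False by simp
qed

text \<open>A majorant of the difference quotients of \<open>t powr z\<close> in the exponent, uniform in
  the step \<open>h\<close>: with \<open>x = ln t\<close>, the quotient is at most \<open>t powr z * \<bar>x\<bar> * exp (h * \<bar>x\<bar>)\<close>, and the
  factor \<open>\<bar>x\<bar>\<close> costs one more power of \<open>exp (d * \<bar>x\<bar>)\<close>. It is what makes differentiation under Euler's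
  integral legitimate.\<close>
lemma powr_quotient_bound:
  fixes t d h z :: real
  assumes "t > 0" "0 < h" "h \<le> d"
  shows "\<bar>(t powr (z + h) - t powr z) / h\<bar> \<le> (t powr (z + 2 * d) + t powr (z - 2 * d)) / d"
proof -
  define x where "x = ln t"
  have "\<bar>t powr h - 1\<bar> \<le> \<bar>h * x\<bar> * exp \<bar>h * x\<bar>"
    using abs_exp_minus_1_le[of "h * x"] assms by (simp add: powr_def x_def)
  hence "\<bar>(t powr h - 1) / h\<bar> \<le> \<bar>x\<bar> * exp (h * \<bar>x\<bar>)"
    using assms by (simp add: field_simps abs_mult)
  also have "\<dots> \<le> exp (d * \<bar>x\<bar>) / d * exp (d * \<bar>x\<bar>)"
  proof (intro mult_mono)
    show "\<bar>x\<bar> \<le> exp (d * \<bar>x\<bar>) / d"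
    proof -
      have "d * \<bar>x\<bar> \<le> exp (d * \<bar>x\<bar>)"
        using exp_ge_add_one_self[of "d * \<bar>x\<bar>"] by linarith
      thus ?thesis using assms by (subst pos_le_divide_eq) (auto simp: mult.commute)
    qed
  qed (use assms in \<open>auto intro!: mult_right_mono\<close>)
  also have "\<dots> = exp (2 * d * \<bar>x\<bar>) / d" by (simp flip: exp_add)
  also have "\<dots> \<le> (t powr (2 * d) + t powr (- (2 * d))) / d"
    using assms by (intro divide_right_mono) (auto simp: powr_def x_def abs_if)
  finally have "t powr z * \<bar>(t powr h - 1) / h\<bar> \<le> t powr z * ((t powr (2 * d) + t powr (- (2 * d))) / d)"
    by (intro mult_left_mono) auto
  also have "t powr z * \<bar>(t powr h - 1) / h\<bar> = \<bar>t powr z * ((t powr h - 1) / h)\<bar>"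
    by (simp add: abs_mult)
  also have "t powr z * ((t powr h - 1) / h) = (t powr (z + h) - t powr z) / h"
    by (simp add: powr_add algebra_simps)
  also have "t powr z * ((t powr (2 * d) + t powr (- (2 * d))) / d) = (t powr (z + 2 * d) + t powr (z - 2 * d)) / d"
    using powr_add[of t z "2*d"] powr_add[of t z "-(2*d)"] by (simp add: algebra_simps)
  finally show ?thesis .
qed

lemma powr_borel_measurable_positive_reals [measurable]:
  "(\<lambda>t. t powr z) \<in> borel_measurable positive_reals"
  by (intro measurable_restrict_space1) measurable

text \<open>The value is the derivative of \<open>Gamma z / \<sigma> powr z\<close> with respect to \<open>z\<close>: differentiate
  the scaled Euler integral under the integral sign, along the steps \<open>h n\<close> and by dominated
  convergence.\<close>
lemma Gamma_log_integral_scaled: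
  fixes z \<sigma> :: real
  assumes z: "z > 0" and \<sigma>: "\<sigma> > 0"
  shows "integrable positive_reals (\<lambda>t. t powr (z - 1) * ln t * exp (- (\<sigma> * t)))"
    and "(LINT t|positive_reals. t powr (z - 1) * ln t * exp (- (\<sigma> * t)))
           = Gamma z * (Digamma z - ln \<sigma>) / \<sigma> powr z"
proof -
  \<comment> \<open>With this step size the majorant has the exponents \<open>z \<plusminus> z / 2 - 1\<close>, and both are larger
  than \<open>- 1\<close>, so that it is integrable at 0.\<close>
  define d where "d = z / 4"
  have d: "d > 0" using z by (simp add: d_def)
  define h where "h n = d / real (Suc n)" for n
  have h: "0 < h n" "h n \<le> d" for n using d by (auto simp: h_def field_simps)
  have h_lim: "filterlim h (at 0) sequentially"
    unfolding filterlim_at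
  proof
    show "h \<longlonglongrightarrow> 0"
      unfolding h_def[abs_def] by (rule LIMSEQ_Suc[OF lim_const_over_n])
    show "\<forall>\<^sub>F n in sequentially. h n \<in> UNIV \<and> h n \<noteq> 0"
      using h(1) by (intro always_eventually) (auto simp: less_imp_neq[symmetric])
  qed
  define s where "s n t = (t powr (z - 1 + h n) - t powr (z - 1)) / h n * exp (- (\<sigma> * t))" for n t
  define w where "w t = (t powr (z + 2 * d - 1) + t powr (z - 2 * d - 1)) / d * exp (- (\<sigma> * t))" for t
  have w_eq: "w t = (1 / d) * (t powr (z + 2 * d - 1) * exp (- (\<sigma> * t)))
      + (1 / d) * (t powr (z - 2 * d - 1) * exp (- (\<sigma> * t)))" for t
    by (simp add: w_def add_divide_distrib ring_distribs)
  have w: "integrable positive_reals w"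
    using Gamma_integral_scaled(1)[of "z + 2 * d" \<sigma>] Gamma_integral_scaled(1)[of "z - 2 * d" \<sigma>] \<sigma> d z
    unfolding w_eq[abs_def]
    by (intro Bochner_Integration.integrable_add integrable_mult_right) (auto simp: d_def)
  have meas: "(\<lambda>t. exp (- (\<sigma> * t))) \<in> borel_measurable positive_reals"
       "ln \<in> borel_measurable positive_reals"
    by (intro measurable_restrict_space1; measurable)+
  note [measurable] = meas
  have s_lim: "AE t in positive_reals. (\<lambda>n. s n t) \<longlonglongrightarrow> t powr (z - 1) * ln t * exp (- (\<sigma> * t))"
  proof (rule AE_I2)
    fix t assume "t \<in> space positive_reals"
    hence t: "t > 0" by (simp add: space_restrict_space)
    have "((\<lambda>u. t powr u) has_field_derivative t powr (z - 1) * ln t) (at (z - 1))"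
      using t by (auto intro!: derivative_eq_intros)
    hence "((\<lambda>h. (t powr (z - 1 + h) - t powr (z - 1)) / h) \<longlongrightarrow> t powr (z - 1) * ln t) (at 0)"
      by (simp add: DERIV_def)
    from filterlim_compose[OF this h_lim]
    show "(\<lambda>n. s n t) \<longlonglongrightarrow> t powr (z - 1) * ln t * exp (- (\<sigma> * t))"
      unfolding s_def by (intro tendsto_mult_right)
  qed
  have s_bound: "AE t in positive_reals. norm (s n t) \<le> w t" for n
  proof (rule AE_I2)
    fix t assume "t \<in> space positive_reals"
    hence t: "t > 0" by (simp add: space_restrict_space)
    have "\<bar>(t powr (z - 1 + h n) - t powr (z - 1)) / h n\<bar> * exp (- (\<sigma> * t)) \<le>
        (t powr (z - 1 + 2 * d) + t powr (z - 1 - 2 * d)) / d * exp (- (\<sigma> * t))"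
      by (intro mult_right_mono powr_quotient_bound t h) auto
    also have "\<dots> = w t" by (simp add: w_def algebra_simps)
    finally show "norm (s n t) \<le> w t" by (simp add: s_def abs_mult)
  qed
  have "s n \<in> borel_measurable positive_reals" for n
    unfolding s_def by measurable
  note dct = this w s_lim s_bound
  show "integrable positive_reals (\<lambda>t. t powr (z - 1) * ln t * exp (- (\<sigma> * t)))"
    by (rule integrable_dominated_convergence[OF _ dct]) measurable
  have lim1: "(\<lambda>n. LINT t|positive_reals. s n t) \<longlonglongrightarrow>
      (LINT t|positive_reals. t powr (z - 1) * ln t * exp (- (\<sigma> * t)))"
    by (rule integral_dominated_convergence[OF _ dct]) measurable
  define \<Phi> where "\<Phi> u = Gamma u / \<sigma> powr u" for u
  have "(LINT t|positive_reals. s n t) = (\<Phi> (z + h n) - \<Phi> z) / h n" for n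
  proof -
    have "(LINT t|positive_reals. s n t) =
        (LINT t|positive_reals. (t powr (z + h n - 1) * exp (- (\<sigma> * t)) - t powr (z - 1) * exp (- (\<sigma> * t))) / h n)"
      by (simp add: s_def algebra_simps)
    also have "\<dots> = (\<Phi> (z + h n) - \<Phi> z) / h n"
      using Gamma_integral_scaled[of "z + h n" \<sigma>] Gamma_integral_scaled[of z \<sigma>] z \<sigma> h(1)[of n]
      by (simp add: \<Phi>_def)
    finally show ?thesis .
  qed
  moreover have "(\<lambda>n. (\<Phi> (z + h n) - \<Phi> z) / h n) \<longlonglongrightarrow> Gamma z * (Digamma z - ln \<sigma>) / \<sigma> powr z"
  proof -
    have "z \<notin> \<int>\<^sub>\<le>\<^sub>0" using z by (auto elim!: nonpos_Ints_cases)
    hence "(\<Phi> has_field_derivative Gamma z * (Digamma z - ln \<sigma>) / \<sigma> powr z) (at z)"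
      unfolding \<Phi>_def using \<sigma> by (auto intro!: derivative_eq_intros simp: field_simps)
    hence "((\<lambda>h. (\<Phi> (z + h) - \<Phi> z) / h) \<longlongrightarrow> Gamma z * (Digamma z - ln \<sigma>) / \<sigma> powr z) (at 0)"
      by (simp add: DERIV_def)
    from filterlim_compose[OF this h_lim] show ?thesis .
  qed
  ultimately show "(LINT t|positive_reals. t powr (z - 1) * ln t * exp (- (\<sigma> * t)))
           = Gamma z * (Digamma z - ln \<sigma>) / \<sigma> powr z"
    using lim1 LIMSEQ_unique by simp
qed

section \<open>The kernel of the differentiated series\<close>

text \<open>This is the derivative of \<open>t powr (z - 1) / Gamma z\<close> with respect to \<open>z\<close>.\<close>
definition log_kernel :: "real \<Rightarrow> real \<Rightarrow> real" where
  "log_kernel z t = t powr (z - 1) * (ln t - Digamma z) / Gamma z"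

text \<open>The function \<open>t powr (z - 1) / Gamma z\<close> has the transform \<open>\<sigma> powr (- z)\<close>, and the
  value is its derivative with respect to \<open>z\<close>: the digamma term of the kernel cancels the one that
  the logarithm produces.\<close>
lemma log_kernel_laplace:
  fixes z \<sigma> :: real
  assumes z: "z > 0" and \<sigma>: "\<sigma> > 0"
  shows "integrable positive_reals (\<lambda>t. log_kernel z t * exp (- (\<sigma> * t)))"
    and "(LINT t|positive_reals. log_kernel z t * exp (- (\<sigma> * t))) = - ln \<sigma> / \<sigma> powr z"
proof -
  have eq: "log_kernel z t * exp (- (\<sigma> * t)) =
      (1 / Gamma z) * (t powr (z - 1) * ln t * exp (- (\<sigma> * t)))
      - (Digamma z / Gamma z) * (t powr (z - 1) * exp (- (\<sigma> * t)))" for t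
    by (simp add: log_kernel_def diff_divide_distrib algebra_simps)
  note int = Gamma_log_integral_scaled(1)[OF assms] Gamma_integral_scaled(1)[OF assms]
  show "integrable positive_reals (\<lambda>t. log_kernel z t * exp (- (\<sigma> * t)))"
    unfolding eq using int by (intro Bochner_Integration.integrable_diff integrable_mult_right)
  have "Gamma z > 0" using z by (rule Gamma_real_pos)
  thus "(LINT t|positive_reals. log_kernel z t * exp (- (\<sigma> * t))) = - ln \<sigma> / \<sigma> powr z"
    unfolding eq using int Gamma_log_integral_scaled(2)[OF assms] Gamma_integral_scaled(2)[OF assms]
    by (simp add: diff_divide_distrib)
qed

text \<open>The logarithm is at most \<open>t\<close> for large \<open>t\<close>; near 0 it is at most
  \<open>t powr (- \<alpha>) / \<alpha>\<close>, which \<open>z \<ge> \<alpha> + \<beta>\<close> can absorb. The second summand is independent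
  of \<open>z\<close>.\<close>
lemma powr_ln_bound:
  fixes t z \<beta> \<alpha> :: real
  assumes t: "t > 0" and \<alpha>: "\<alpha> > 0" and z: "z \<ge> \<alpha> + \<beta>"
  shows "t powr (z - 1) * \<bar>ln t\<bar> \<le> t powr z + t powr (\<beta> - 1) / \<alpha>"
proof (cases "t \<ge> 1")
  case True
  have "t powr (z - 1) * \<bar>ln t\<bar> \<le> t powr (z - 1) * t"
    using True ln_le_minus_one[of t] by (intro mult_left_mono) auto
  also have "\<dots> = t powr z" using t by (simp add: powr_diff)
  finally show ?thesis using \<alpha> by (simp add: add_increasing2)
next
  case False
  have "\<alpha> * \<bar>ln t\<bar> \<le> exp (\<alpha> * \<bar>ln t\<bar>)"
    using exp_ge_add_one_self[of "\<alpha> * \<bar>ln t\<bar>"] by linarith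
  also have "\<dots> = t powr (- \<alpha>)" using False t by (simp add: powr_def)
  finally have "\<bar>ln t\<bar> \<le> t powr (- \<alpha>) / \<alpha>" using \<alpha> by (simp add: field_simps)
  moreover have "t powr (z - 1) \<le> t powr (\<alpha> + \<beta> - 1)"
    using False t z by (intro powr_mono') auto
  ultimately have "t powr (z - 1) * \<bar>ln t\<bar> \<le> t powr (\<alpha> + \<beta> - 1) * (t powr (- \<alpha>) / \<alpha>)"
    by (intro mult_mono) auto
  also have "\<dots> = t powr (\<beta> - 1) / \<alpha>"
    by (simp flip: powr_add)
  finally show ?thesis by (simp add: add_increasing)
qed

text \<open>The factor \<open>\<sigma> powr (- z)\<close> of the signed integral survives in the \<open>L\<^sup>1\<close> norm, and only a
  factor linear in \<open>z\<close> is lost. The bound on the logarithm gives three Gamma integrals; after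
  division by \<open>Gamma z\<close> they are \<open>z / \<sigma> powr (z + 1)\<close>, a multiple of \<open>1 / Gamma z\<close>, and the digamma part.
  The middle one is compared with \<open>\<sigma> powr (- z)\<close> through the lower bound for \<open>Gamma\<close> at
  \<open>S = \<sigma>\<close>.\<close>
lemma log_kernel_L1_bound:
  fixes \<alpha> \<beta> \<sigma> :: real
  assumes \<alpha>: "\<alpha> > 0" and \<beta>: "\<beta> > 0" and \<sigma>: "\<sigma> > 0"
  obtains C where "\<And>z. z \<ge> \<alpha> + \<beta> \<Longrightarrow>
    (LINT t|positive_reals. norm (log_kernel z t * exp (- (\<sigma> * t)))) \<le> C * (1 + z) / \<sigma> powr z"
proof -
  obtain A where A: "A > 0" "\<And>z. z \<ge> \<alpha> + \<beta> \<Longrightarrow> \<bar>Digamma z\<bar> \<le> A * (1 + z)"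
    using Digamma_linear_bound[of "\<alpha> + \<beta>"] \<alpha> \<beta> by auto
  define c where "c = exp (-(\<sigma>+1)) / (\<sigma>+1)"
  have c: "c > 0" using \<sigma> by (simp add: c_def)
  define B where "B = Gamma \<beta> / (\<sigma> powr \<beta> * \<alpha>)"
  have B: "B > 0" using \<alpha> \<beta> \<sigma> by (simp add: B_def Gamma_real_pos)
  show ?thesis
  proof (rule that[of "1 / \<sigma> + B / c + A"])
    fix z assume z: "z \<ge> \<alpha> + \<beta>"
    have z0: "z > 0" using z \<alpha> \<beta> by linarith
    have G: "Gamma z > 0" using z0 by (rule Gamma_real_pos)
    define E where "E p t = t powr (p - 1) * exp (- (\<sigma> * t))" for p t :: real
    have E_int: "integrable positive_reals (E p)" and E_val: "integral\<^sup>L positive_reals (E p) = Gamma p / \<sigma> powr p"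
      if "p > 0" for p
      using Gamma_integral_scaled[OF that \<sigma>] by (simp_all add: E_def[abs_def])
    define w where "w t = (E (z + 1) t + E \<beta> t / \<alpha> + A * (1 + z) * E z t) / Gamma z" for t
    have le: "norm (log_kernel z t * exp (- (\<sigma> * t))) \<le> w t" if "t \<in> space positive_reals" for t
    proof -
      have t: "t > 0" using that by (simp add: space_restrict_space)
      have "t powr (z - 1) * \<bar>ln t - Digamma z\<bar> \<le> t powr (z - 1) * (\<bar>ln t\<bar> + A * (1 + z))"
        using A(2)[OF z] by (intro mult_left_mono) auto
      also have "\<dots> \<le> t powr z + t powr (\<beta> - 1) / \<alpha> + t powr (z - 1) * (A * (1 + z))"
        using powr_ln_bound[OF t \<alpha> z] by (simp add: distrib_left)
      finally have "t powr (z - 1) * \<bar>ln t - Digamma z\<bar> / Gamma z * exp (- (\<sigma> * t)) \<le>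
         (t powr z + t powr (\<beta> - 1) / \<alpha> + t powr (z - 1) * (A * (1 + z))) / Gamma z * exp (- (\<sigma> * t))"
        using G by (intro mult_right_mono divide_right_mono) auto
      also have "\<dots> = w t" by (simp add: w_def E_def algebra_simps add_divide_distrib)
      finally show ?thesis using G by (simp add: log_kernel_def abs_mult)
    qed
    have w_int: "integrable positive_reals w"
      unfolding w_def using E_int[of "z+1"] E_int[of \<beta>] E_int[of z] z0 \<beta> by simp
    have "(LINT t|positive_reals. norm (log_kernel z t * exp (- (\<sigma> * t)))) \<le> integral\<^sup>L positive_reals w"
      using log_kernel_laplace(1)[OF z0 \<sigma>] w_int le by (intro integral_mono) auto
    also have "integral\<^sup>L positive_reals w =
        (Gamma (z + 1) / \<sigma> powr (z + 1) + Gamma \<beta> / \<sigma> powr \<beta> / \<alpha> + A * (1 + z) * (Gamma z / \<sigma> powr z)) / Gamma z"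
      unfolding w_def using E_int[of "z+1"] E_int[of \<beta>] E_int[of z] z0 \<beta> by (simp add: E_val)
    also have "\<dots> = (z / \<sigma>) / \<sigma> powr z + B / Gamma z + A * (1 + z) / \<sigma> powr z"
    proof -
      have "z \<notin> \<int>\<^sub>\<le>\<^sub>0" using z0 by (auto elim!: nonpos_Ints_cases)
      hence "Gamma (z + 1) = z * Gamma z" by (rule Gamma_plus1)
      thus ?thesis using G \<sigma> by (simp add: B_def powr_add add_divide_distrib)
    qed
    also have "\<dots> \<le> ((1 + z) / \<sigma>) / \<sigma> powr z + (B / c * (1 + z)) / \<sigma> powr z + A * (1 + z) / \<sigma> powr z"
    proof (intro add_mono divide_right_mono)
      have "B / Gamma z \<le> B / (\<sigma> powr z * c)"
        using Gamma_ge_powr[OF z0 \<sigma>] B c \<sigma> G by (intro divide_left_mono) (auto simp: c_def)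
      also have "\<dots> = B / c * 1 / \<sigma> powr z" by simp
      also have "\<dots> \<le> (B / c * (1 + z)) / \<sigma> powr z"
        using B c z0 by (intro divide_right_mono mult_left_mono) auto
      finally show "B / Gamma z \<le> (B / c * (1 + z)) / \<sigma> powr z" .
    qed (use \<sigma> in auto)
    also have "\<dots> = (1 / \<sigma> + B / c + A) * (1 + z) / \<sigma> powr z"
      by (simp add: add_divide_distrib ring_distribs)
    finally show "(LINT t|positive_reals. norm (log_kernel z t * exp (- (\<sigma> * t))))
        \<le> (1 / \<sigma> + B / c + A) * (1 + z) / \<sigma> powr z" .
  qed
qed

section \<open>Termwise integration of the series\<close>

text \<open>Comparison with the second derivative of the geometric series, whose terms are
  \<open>(k + 1) * (k + 2) * q ^ k\<close>.\<close>
lemma summable_quadratic_geometric: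
  fixes q a b :: real
  assumes "0 \<le> q" "q < 1"
  shows "summable (\<lambda>k. real k * (a + b * real k) * q ^ k)"
proof -
  have 1: "summable (\<lambda>k. diffs (\<lambda>_. 1) k * x ^ k)" if "norm x < 1" for x :: real
    by (rule termdiff_converges[of _ 1]) (use that summable_geometric in auto)
  have "summable (\<lambda>k. diffs (diffs (\<lambda>_. 1)) k * q ^ k)"
    by (rule termdiff_converges[of _ 1]) (use assms 1 in auto)
  hence "summable (\<lambda>k. (\<bar>a\<bar> + \<bar>b\<bar>) * (diffs (diffs (\<lambda>_. 1)) k * q ^ k))"
    by (rule summable_mult)
  thus ?thesis
  proof (rule summable_comparison_test'[of _ 0])
    fix k :: nat
    have "\<bar>a + b * real k\<bar> \<le> \<bar>a\<bar> + \<bar>b\<bar> * real k"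
      using abs_triangle_ineq[of a "b * real k"] by (simp add: abs_mult)
    also have "\<dots> \<le> (\<bar>a\<bar> + \<bar>b\<bar>) * (real k + 2)"
      by (simp add: algebra_simps)
    finally have "real k * \<bar>a + b * real k\<bar> \<le> (real k + 1) * ((\<bar>a\<bar> + \<bar>b\<bar>) * (real k + 2))"
      by (intro mult_mono) auto
    hence "real k * \<bar>a + b * real k\<bar> * q ^ k \<le> (real k + 1) * ((\<bar>a\<bar> + \<bar>b\<bar>) * (real k + 2)) * q ^ k"
      using assms by (intro mult_right_mono) auto
    thus "norm (real k * (a + b * real k) * q ^ k) \<le> (\<bar>a\<bar> + \<bar>b\<bar>) * (diffs (diffs (\<lambda>_. 1)) k * q ^ k)"
      using assms by (simp add: diffs_def abs_mult mult_ac add_ac)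
  qed
qed

text \<open>With \<open>q = l / \<sigma> powr \<alpha>\<close>, the terms have \<open>L\<^sup>1\<close> norms bounded by a polynomial in \<open>k\<close>
  times \<open>\<bar>q\<bar> ^ k\<close>, so sum and integral may be exchanged, and the sum is
  \<open>- ln \<sigma> / \<sigma> powr \<beta>\<close> times \<open>\<Sum>k. k * q ^ k = q / (1 - q)\<^sup>2\<close>.\<close>
lemma log_kernel_series_laplace:
  fixes \<alpha> \<beta> \<sigma> l :: real
  assumes \<alpha>: "\<alpha> > 0" and \<beta>: "\<beta> > 0" and \<sigma>: "\<sigma> > 0" and l: "\<bar>l\<bar> < \<sigma> powr \<alpha>"
  assumes pointwise: "\<And>t. t > 0 \<Longrightarrow> summable (\<lambda>k. norm (real k * l ^ k * log_kernel (\<alpha> * real k + \<beta>) t))"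
  shows "integrable positive_reals
           (\<lambda>t. (\<Sum>k. real k * l ^ k * log_kernel (\<alpha> * real k + \<beta>) t) * exp (- (\<sigma> * t)))"
    and "(LINT t|positive_reals. (\<Sum>k. real k * l ^ k * log_kernel (\<alpha> * real k + \<beta>) t) * exp (- (\<sigma> * t)))
           = - (l * \<sigma> powr (\<alpha> - \<beta>) * ln \<sigma>) / (\<sigma> powr \<alpha> - l)\<^sup>2"
proof -
  define z where "z k = \<alpha> * real k + \<beta>" for k
  have z: "z k > 0" for k using \<alpha> \<beta> by (auto simp: z_def intro!: add_nonneg_pos)
  define g where "g k t = real k * l ^ k * (log_kernel (z k) t * exp (- (\<sigma> * t)))" for k t
  define q where "q = l / \<sigma> powr \<alpha>"
  have q: "\<bar>q\<bar> < 1" using l \<sigma> by (simp add: q_def)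
  have powr_z: "l ^ k / \<sigma> powr z k = q ^ k / \<sigma> powr \<beta>" for k
    using \<sigma> by (simp add: q_def z_def powr_add power_divide powr_powr[symmetric] flip: powr_realpow)
  obtain C where C: "\<And>z. z \<ge> \<alpha> + \<beta> \<Longrightarrow>
    (LINT t|positive_reals. norm (log_kernel z t * exp (- (\<sigma> * t)))) \<le> C * (1 + z) / \<sigma> powr z"
    using log_kernel_L1_bound[OF \<alpha> \<beta> \<sigma>] by blast
  have g_int: "integrable positive_reals (g k)" for k
    unfolding g_def[abs_def] using log_kernel_laplace(1)[OF z \<sigma>] by (intro integrable_mult_right)
  have suminf_g: "(\<Sum>k. g k t) = (\<Sum>k. real k * l ^ k * log_kernel (\<alpha> * real k + \<beta>) t) * exp (- (\<sigma> * t))"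
    if "t > 0" for t
    using suminf_mult2[OF summable_norm_cancel[OF pointwise[OF that]], of "exp (- (\<sigma> * t))"]
    by (simp add: g_def z_def mult_ac)
  have ae: "AE t in positive_reals. summable (\<lambda>k. norm (g k t))"
  proof (rule AE_I2)
    fix t assume "t \<in> space positive_reals"
    hence "t > 0" by (simp add: space_restrict_space)
    from summable_mult2[OF pointwise[OF this], of "exp (- (\<sigma> * t))"]
    show "summable (\<lambda>k. norm (g k t))" by (simp add: g_def z_def abs_mult mult_ac)
  qed
  have norms: "summable (\<lambda>k. LINT t|positive_reals. norm (g k t))"
  proof (rule summable_comparison_test'[of _ 0])
    show "summable (\<lambda>k. C / \<sigma> powr \<beta> * (real k * ((1 + \<beta>) + \<alpha> * real k) * \<bar>q\<bar> ^ k))"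
      using q by (intro summable_mult summable_quadratic_geometric) auto
    fix k :: nat
    have "(LINT t|positive_reals. norm (g k t)) =
        real k * \<bar>l\<bar> ^ k * (LINT t|positive_reals. norm (log_kernel (z k) t * exp (- (\<sigma> * t))))"
      by (simp add: g_def abs_mult power_abs)
    also have "\<dots> \<le> real k * \<bar>l\<bar> ^ k * (C * (1 + z k) / \<sigma> powr z k)"
    \<comment> \<open>The norm bound needs an argument of at least \<open>\<alpha> + \<beta>\<close>; the index 0 falls short of it,
  but its term has the factor \<open>k = 0\<close>.\<close>
    proof (cases "k = 0")
      case False
      hence "\<alpha> * 1 \<le> \<alpha> * real k" using \<alpha> by (intro mult_left_mono) auto
      hence "z k \<ge> \<alpha> + \<beta>" by (simp add: z_def)
      thus ?thesis by (intro mult_left_mono C) auto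
    qed auto
    also have "\<dots> = C * (real k * (1 + z k)) * \<bar>l ^ k / \<sigma> powr z k\<bar>"
      by (simp add: power_abs)
    also have "\<dots> = C / \<sigma> powr \<beta> * (real k * ((1 + \<beta>) + \<alpha> * real k) * \<bar>q\<bar> ^ k)"
      unfolding powr_z by (simp add: power_abs z_def algebra_simps)
    finally show "norm (LINT t|positive_reals. norm (g k t)) \<le>
        C / \<sigma> powr \<beta> * (real k * ((1 + \<beta>) + \<alpha> * real k) * \<bar>q\<bar> ^ k)"
      by (simp add: integral_nonneg_AE)
  qed
  have "integrable positive_reals (\<lambda>t. \<Sum>k. g k t)"
    by (intro integrable_suminf g_int ae norms)
  thus "integrable positive_reals
           (\<lambda>t. (\<Sum>k. real k * l ^ k * log_kernel (\<alpha> * real k + \<beta>) t) * exp (- (\<sigma> * t)))"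
    by (rule Bochner_Integration.integrable_cong[THEN iffD1, rotated -1])
       (auto simp: suminf_g space_restrict_space)
  have "(\<lambda>k. integral\<^sup>L positive_reals (g k)) sums (LINT t|positive_reals. (\<Sum>k. g k t))"
    by (intro sums_integral g_int ae norms)
  also have "(LINT t|positive_reals. (\<Sum>k. g k t)) =
     (LINT t|positive_reals. (\<Sum>k. real k * l ^ k * log_kernel (\<alpha> * real k + \<beta>) t) * exp (- (\<sigma> * t)))"
    by (rule Bochner_Integration.integral_cong) (auto simp: suminf_g space_restrict_space)
  also have "(\<lambda>k. integral\<^sup>L positive_reals (g k)) = (\<lambda>k. - ln \<sigma> / \<sigma> powr \<beta> * (real k * q ^ k))"
  proof
    fix k
    have "integral\<^sup>L positive_reals (g k) = - ln \<sigma> * real k * (l ^ k / \<sigma> powr z k)"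
      unfolding g_def[abs_def] using log_kernel_laplace[OF z[of k] \<sigma>] by simp
    thus "integral\<^sup>L positive_reals (g k) = - ln \<sigma> / \<sigma> powr \<beta> * (real k * q ^ k)"
      by (simp add: powr_z)
  qed
  finally have sums1: "(\<lambda>k. - ln \<sigma> / \<sigma> powr \<beta> * (real k * q ^ k)) sums
     (LINT t|positive_reals. (\<Sum>k. real k * l ^ k * log_kernel (\<alpha> * real k + \<beta>) t) * exp (- (\<sigma> * t)))" .
  have "(\<lambda>k. real (Suc k) * q ^ k * q) sums (1 / (1 - q)\<^sup>2 * q)"
    using q by (intro sums_mult2 geometric_deriv_sums) auto
  hence "(\<lambda>k. real (Suc k) * q ^ Suc k) sums (q / (1 - q)\<^sup>2)" by (simp add: mult_ac)
  hence "(\<lambda>k. real k * q ^ k) sums (q / (1 - q)\<^sup>2)"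
    by (subst (asm) sums_Suc_iff) simp
  hence sums2: "(\<lambda>k. - ln \<sigma> / \<sigma> powr \<beta> * (real k * q ^ k)) sums (- ln \<sigma> / \<sigma> powr \<beta> * (q / (1 - q)\<^sup>2))"
    by (rule sums_mult)
  have "\<sigma> powr \<alpha> \<noteq> l" using l by auto
  hence "- ln \<sigma> / \<sigma> powr \<beta> * (q / (1 - q)\<^sup>2) = - (l * \<sigma> powr (\<alpha> - \<beta>) * ln \<sigma>) / (\<sigma> powr \<alpha> - l)\<^sup>2"
    using \<sigma> by (simp add: q_def powr_diff power2_eq_square divide_simps)
  with sums_unique2[OF sums1 sums2]
  show "(LINT t|positive_reals. (\<Sum>k. real k * l ^ k * log_kernel (\<alpha> * real k + \<beta>) t) * exp (- (\<sigma> * t)))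
           = - (l * \<sigma> powr (\<alpha> - \<beta>) * ln \<sigma>) / (\<sigma> powr \<alpha> - l)\<^sup>2" by simp
qed

section \<open>Differentiation with respect to the parameter\<close>

text \<open>Termwise differentiation, justified by the Weierstrass test on the compact neighbourhood
  \<open>{\<alpha> / 2..2 * \<alpha>}\<close> of \<open>\<alpha>\<close>. There \<open>\<bar>l * t powr a\<bar>\<close> is at most a constant \<open>p\<close>, and the lower bound
  for \<open>Gamma\<close> with a large \<open>S\<close> makes the differentiated terms decay geometrically, up to a
  quadratic polynomial in \<open>k\<close>.\<close>
lemma mittag_leffler_has_parameter_derivative:
  fixes \<alpha> \<beta> x l t :: real
  assumes \<alpha>: "\<alpha> > 0" and \<beta>: "\<beta> > 0" and t: "t > 0"
  shows "summable (\<lambda>k. norm (real k * l ^ k * log_kernel (\<alpha> * real k + \<beta>) t))"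
    and "((\<lambda>a. t powr (\<beta> - 1) * mittag_leffler a \<beta> (l * t powr a)) has_field_derivative
           (\<Sum>k. real k * l ^ k * log_kernel (\<alpha> * real k + \<beta>) t)) (at \<alpha>)"
proof -
  define z where "z a k = a * real k + \<beta>" for a k
  define f where "f k a = (l * t powr a) ^ k / Gamma (z a k)" for k a
  define f' where "f' k a = real k * (l * t powr a) ^ k * (ln t - Digamma (z a k)) / Gamma (z a k)" for k a
  define J where "J = {\<alpha> / 2..2 * \<alpha>}"
  have J: "\<alpha> \<in> J" "\<alpha> \<in> interior J" "convex J" using \<alpha> by (auto simp: J_def)
  have J_pos: "a > 0" if "a \<in> J" for a using that \<alpha> by (auto simp: J_def)
  have z_ge: "z a k \<ge> \<beta>" if "a \<in> J" for a k using J_pos[OF that] by (simp add: z_def)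
  have z_pos: "z a k > 0" if "a \<in> J" for a k using z_ge[OF that, of k] \<beta> by linarith
  define p where "p = \<bar>l\<bar> * max 1 t powr (2 * \<alpha>)"
  have p: "p \<ge> 0" by (simp add: p_def)
  \<comment> \<open>Chosen so that \<open>S powr a\<close> is at least \<open>1 + 2 * p\<close> for every \<open>a \<ge> \<alpha> / 2\<close>; the ratio
  \<open>q\<close> is then smaller than 1.\<close>
  define S where "S = (1 + 2 * p) powr (2 / \<alpha>)"
  have S: "S \<ge> 1" using p \<alpha> by (auto simp: S_def intro!: ge_one_powr_ge_zero)
  have S_powr: "S powr (\<alpha> / 2) = 1 + 2 * p" using p \<alpha> by (simp add: S_def powr_powr)
  define q where "q = p / (1 + 2 * p)"
  have q: "0 \<le> q" "q < 1" using p by (auto simp: q_def field_simps)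
  define c where "c = exp (-(S+1)) / (S+1)"
  have c: "c > 0" using S by (simp add: c_def)
  have term_bound: "\<bar>l * t powr a\<bar> ^ k / Gamma (z a k) \<le> q ^ k / c" if a: "a \<in> J" for a k
  proof -
    have "t powr a \<le> max 1 t powr a" using t J_pos[OF a] by (intro powr_mono2) auto
    also have "\<dots> \<le> max 1 t powr (2 * \<alpha>)" using a by (intro powr_mono) (auto simp: J_def)
    finally have num: "\<bar>l * t powr a\<bar> \<le> p" by (simp add: p_def abs_mult mult_left_mono)
    have "(1 + 2 * p) ^ k = (S powr (\<alpha> / 2)) powr real k"
      using p by (simp add: S_powr powr_realpow)
    also have "\<dots> = S powr (\<alpha> / 2 * real k)" by (rule powr_powr)
    also have "\<dots> \<le> S powr z a k"
    proof (intro powr_mono S)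
      have "\<alpha> / 2 * real k \<le> a * real k" using a by (intro mult_right_mono) (auto simp: J_def)
      thus "\<alpha> / 2 * real k \<le> z a k" using \<beta> by (simp add: z_def)
    qed
    finally have "(1 + 2 * p) ^ k * c \<le> S powr z a k * c" using c by (intro mult_right_mono) auto
    also have "\<dots> \<le> Gamma (z a k)" unfolding c_def using S by (intro Gamma_ge_powr z_pos a) auto
    finally have "\<bar>l * t powr a\<bar> ^ k / Gamma (z a k) \<le> p ^ k / ((1 + 2 * p) ^ k * c)"
      using p c num by (intro frac_le power_mono) auto
    thus ?thesis by (simp add: q_def power_divide)
  qed
  obtain A where A: "A > 0" "\<And>z. z \<ge> \<beta> \<Longrightarrow> \<bar>Digamma z\<bar> \<le> A * (1 + z)"
    using Digamma_linear_bound[OF \<beta>] by blast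
  define M where "M k = (real k * ((\<bar>ln t\<bar> + A * (1 + \<beta>)) + (2 * A * \<alpha>) * real k) * q ^ k) * (1 / c)" for k
  have M: "summable M"
    unfolding M_def by (intro summable_mult2 summable_quadratic_geometric q)
  have f'_bound: "norm (f' k a) \<le> M k" if a: "a \<in> J" for k a
  proof -
    have "\<bar>ln t - Digamma (z a k)\<bar> \<le> \<bar>ln t\<bar> + A * (1 + z a k)"
      using A(2)[OF z_ge[OF a, of k]] by linarith
    also have "z a k \<le> 2 * \<alpha> * real k + \<beta>"
      using a by (auto simp: z_def J_def intro!: mult_right_mono)
    finally have "\<bar>ln t - Digamma (z a k)\<bar> \<le> (\<bar>ln t\<bar> + A * (1 + \<beta>)) + (2 * A * \<alpha>) * real k"
      using A(1) by (simp add: algebra_simps)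
    hence "real k * \<bar>ln t - Digamma (z a k)\<bar> * (\<bar>l * t powr a\<bar> ^ k / Gamma (z a k))
      \<le> real k * ((\<bar>ln t\<bar> + A * (1 + \<beta>)) + (2 * A * \<alpha>) * real k) * (q ^ k / c)"
      using term_bound[OF a, of k] Gamma_real_pos[OF z_pos[OF a], of k] A \<alpha> \<beta>
      by (intro mult_mono mult_left_mono) (auto intro!: mult_nonneg_nonneg add_nonneg_nonneg)
    thus ?thesis
      using Gamma_real_pos[OF z_pos[OF a], of k]
      by (simp add: f'_def M_def abs_mult power_abs mult_ac)
  qed
  have deriv: "(f k has_field_derivative f' k a) (at a within J)" if a: "a \<in> J" for k a
  proof -
    have nz: "z a k \<notin> \<int>\<^sub>\<le>\<^sub>0" using z_pos[OF a, of k] by (auto elim!: nonpos_Ints_cases)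
    have G: "Gamma (z a k) \<noteq> 0" using Gamma_real_pos[OF z_pos[OF a], of k] by simp
    have "((\<lambda>a. l * t powr a) has_field_derivative l * t powr a * ln t) (at a)"
      using t by (auto intro!: derivative_eq_intros)
    from DERIV_power[OF has_field_derivative_at_within[OF this], of k J]
    have num: "((\<lambda>a. (l * t powr a) ^ k) has_field_derivative
        real k * ((l * t powr a) ^ k * ln t)) (at a within J)"
      by (cases k) (simp_all add: mult_ac)
    have den: "((\<lambda>a. Gamma (z a k)) has_field_derivative
        Gamma (z a k) * Digamma (z a k) * real k) (at a within J)"
      using nz unfolding z_def by (auto intro!: derivative_eq_intros)
    from DERIV_divide[OF num den G] show ?thesis
      unfolding f_def[abs_def]
      by (rule DERIV_cong) (use G in \<open>simp add: f'_def field_simps\<close>)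
  qed
  have f_summable: "summable (\<lambda>k. f k \<alpha>)"
  proof (rule summable_comparison_test'[of _ 0])
    show "summable (\<lambda>k. q ^ k * (1 / c))" using q by (intro summable_mult2 summable_geometric) auto
    show "norm (f k \<alpha>) \<le> q ^ k * (1 / c)" for k
      using term_bound[OF J(1), of k] Gamma_real_pos[OF z_pos[OF J(1)], of k]
      by (simp add: f_def power_abs)
  qed
  have f'_eq: "t powr (\<beta> - 1) * f' k \<alpha> = real k * l ^ k * log_kernel (\<alpha> * real k + \<beta>) t" for k
  proof -
    have "t powr (\<alpha> * real k + \<beta> - 1) = t powr (\<beta> - 1) * (t powr \<alpha>) ^ k"
      using t by (simp add: powr_powr powr_add[symmetric] add_ac diff_add_eq flip: powr_realpow)
    thus ?thesis by (simp add: f'_def log_kernel_def z_def power_mult_distrib)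
  qed
  have "summable (\<lambda>k. norm (f' k \<alpha>))"
    by (rule summable_comparison_test'[OF M, of 0]) (use f'_bound[OF J(1)] in simp)
  hence "summable (\<lambda>k. t powr (\<beta> - 1) * norm (f' k \<alpha>))" by (rule summable_mult)
  thus "summable (\<lambda>k. norm (real k * l ^ k * log_kernel (\<alpha> * real k + \<beta>) t))"
    by (simp add: f'_eq[symmetric] abs_mult)
  have "uniformly_convergent_on J (\<lambda>n a. \<Sum>k<n. f' k a)"
    by (rule Weierstrass_m_test'[OF f'_bound M])
  from has_field_derivative_series'(2)[OF J(3) deriv this J(1) f_summable J(2)]
  have "((\<lambda>a. \<Sum>k. f k a) has_field_derivative (\<Sum>k. f' k \<alpha>)) (at \<alpha>)" .
  from DERIV_cmult[OF this, of "t powr (\<beta> - 1)"]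
  have "((\<lambda>a. t powr (\<beta> - 1) * mittag_leffler a \<beta> (l * t powr a)) has_field_derivative
           t powr (\<beta> - 1) * (\<Sum>k. f' k \<alpha>)) (at \<alpha>)"
    by (simp add: mittag_leffler_def f_def z_def)
  also have "t powr (\<beta> - 1) * (\<Sum>k. f' k \<alpha>) = (\<Sum>k. t powr (\<beta> - 1) * f' k \<alpha>)"
    using summable_norm_cancel[OF \<open>summable (\<lambda>k. norm (f' k \<alpha>))\<close>] by (rule suminf_mult[symmetric])
  finally show "((\<lambda>a. t powr (\<beta> - 1) * mittag_leffler a \<beta> (l * t powr a)) has_field_derivative
           (\<Sum>k. real k * l ^ k * log_kernel (\<alpha> * real k + \<beta>) t)) (at \<alpha>)"
    by (simp add: f'_eq)
qed

section \<open>Laplace transforms as holomorphic functions\<close>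

lemma laplace_converges_iff:
  "laplace_converges f s \<longleftrightarrow> integrable positive_reals (\<lambda>t. exp (- (s * of_real t)) * of_real (f t))"
  unfolding laplace_converges_def set_integrable_def by (subst integrable_restrict_space) auto

lemma laplace_eq_integral:
  "laplace f s = (LINT t|positive_reals. exp (- (s * of_real t)) * of_real (f t))"
  unfolding laplace_def set_lebesgue_integral_def by (subst integral_restrict_space) auto

lemma cexp_borel_measurable_positive_reals [measurable]:
  "(\<lambda>t. exp (c * complex_of_real t)) \<in> borel_measurable positive_reals"
proof -
  have "(\<lambda>t. exp (c * complex_of_real t)) \<in> borel_measurable borel"
    by (intro borel_measurable_continuous_onI continuous_intros)
  thus ?thesis by (intro measurable_restrict_space1) simp
qed

lemma laplace_integrand_borel_measurable:
  assumes "laplace_converges f s0"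
  shows "(\<lambda>t. exp (- (s * of_real t)) * complex_of_real (f t)) \<in> borel_measurable positive_reals"
proof -
  have [measurable]: "(\<lambda>t. exp (- (s0 * of_real t)) * complex_of_real (f t)) \<in> borel_measurable positive_reals"
    using assms by (auto simp: laplace_converges_iff)
  have "(\<lambda>t. exp ((s0 - s) * complex_of_real t) * (exp (- (s0 * of_real t)) * complex_of_real (f t)))
      \<in> borel_measurable positive_reals"
    by measurable
  also have "(\<lambda>t. exp ((s0 - s) * complex_of_real t) * (exp (- (s0 * of_real t)) * complex_of_real (f t)))
      = (\<lambda>t. exp (- (s * of_real t)) * complex_of_real (f t))"
    unfolding mult.assoc[symmetric] exp_add[symmetric] by (simp add: algebra_simps)
  finally show ?thesis .
qed

lemma laplace_converges_mono:
  assumes "laplace_converges f s0" "Re s0 \<le> Re s"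
  shows "laplace_converges f s"
  unfolding laplace_converges_iff
proof (rule Bochner_Integration.integrable_bound)
  show "integrable positive_reals (\<lambda>t. exp (- (s0 * of_real t)) * complex_of_real (f t))"
    using assms(1) by (simp add: laplace_converges_iff)
  show "(\<lambda>t. exp (- (s * of_real t)) * complex_of_real (f t)) \<in> borel_measurable positive_reals"
    by (rule laplace_integrand_borel_measurable[OF assms(1)])
  show "AE t in positive_reals. norm (exp (- (s * of_real t)) * complex_of_real (f t))
          \<le> norm (exp (- (s0 * of_real t)) * complex_of_real (f t))"
    using assms(2) by (intro AE_I2) (auto simp: space_restrict_space norm_mult intro!: mult_right_mono)
qed

text \<open>Around a point \<open>s\<close> of the open half-plane, expand \<open>exp (- (w * t))\<close> in powers of
  \<open>w - s\<close> and integrate termwise. On the disc of radius \<open>r = Re s - Re s0\<close> the absolute values of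
  all partial sums stay below \<open>exp (r * t) * exp (- Re s * t) * \<bar>f t\<bar>\<close>, which is the absolute
  value \<open>W\<close> of the integrand at \<open>s0\<close>, hence integrable. So the transform has a power series there.\<close>
lemma laplace_holomorphic:
  assumes conv: "laplace_converges f s0"
  shows "laplace f holomorphic_on {s. Re s0 < Re s}"
proof -
  have "laplace f analytic_on {s}" if s: "Re s0 < Re s" for s
  proof -
    define r where "r = Re s - Re s0"
    have r: "r > 0" using s by (simp add: r_def)
    have meas [measurable]: "(\<lambda>t. exp (- (s * of_real t)) * complex_of_real (f t)) \<in> borel_measurable positive_reals"
      by (rule laplace_integrand_borel_measurable[OF conv])
    have measn [measurable]: "(\<lambda>t. complex_of_real t ^ n) \<in> borel_measurable positive_reals" for n
      by (intro measurable_restrict_space1) measurable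
    define g where "g n t = of_real t ^ n / fact n * (exp (- (s * of_real t)) * complex_of_real (f t))" for n t
    define W where "W t = norm (exp (- (s0 * of_real t)) * complex_of_real (f t))" for t
    have W: "integrable positive_reals W"
      unfolding W_def using conv by (simp add: laplace_converges_iff)
    have g_meas [measurable]: "g n \<in> borel_measurable positive_reals" for n
      unfolding g_def[abs_def] by measurable
    have series_le: "(\<Sum>n<N. norm (g n t) * x ^ n) \<le> W t" if "t > 0" "0 \<le> x" "x \<le> r" for N t x
    proof -
      have "(\<Sum>n<N. norm (g n t) * x ^ n) =
         (\<Sum>n<N. (x * t) ^ n /\<^sub>R fact n) * norm (exp (- (s * of_real t)) * complex_of_real (f t))"
        unfolding sum_distrib_right using that
        by (intro sum.cong) (auto simp: g_def norm_mult norm_divide norm_power power_mult_distrib divide_inverse norm_inverse mult_ac)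
      also have "(\<Sum>n<N. (x * t) ^ n /\<^sub>R fact n) \<le> (\<Sum>n. (x * t) ^ n /\<^sub>R fact n)"
        using that summable_exp_generic[of "x * t"] by (intro sum_le_suminf) auto
      also have "\<dots> = exp (x * t)" by (simp add: exp_def)
      also have "\<dots> \<le> exp (r * t)" using that by simp
      also have "exp (r * t) * norm (exp (- (s * of_real t)) * complex_of_real (f t)) = W t"
        unfolding W_def norm_mult mult.assoc[symmetric] norm_exp_eq_Re exp_add[symmetric]
        by (simp add: r_def algebra_simps)
      finally show ?thesis by (simp add: mult_right_mono)
    qed
    have g_int: "integrable positive_reals (g n)" for n
    proof (rule Bochner_Integration.integrable_bound[OF integrable_mult_right[OF W, of "1 / r ^ n"]])
      show "AE t in positive_reals. norm (g n t) \<le> norm (1 / r ^ n * W t)"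
      proof (rule AE_I2)
        fix t assume "t \<in> space positive_reals"
        hence t: "t > 0" by (simp add: space_restrict_space)
        have "norm (g n t) * r ^ n \<le> (\<Sum>k<Suc n. norm (g k t) * r ^ k)"
          using r by (intro member_le_sum) auto
        also have "\<dots> \<le> W t" using t r by (intro series_le) auto
        finally show "norm (g n t) \<le> norm (1 / r ^ n * W t)"
          using r by (simp add: W_def abs_mult field_simps)
      qed
    qed auto
    \<comment> \<open>The functions \<open>G n\<close> are the terms of the expansion of the integrand at \<open>w\<close>.\<close>
    have "(\<lambda>n. (-1) ^ n * integral\<^sup>L positive_reals (g n) * (w - s) ^ n) sums laplace f w" if w: "w \<in> ball s r" for w
    proof -
      define x where "x = norm (w - s)"
      have x: "0 \<le> x" "x \<le> r" using w by (auto simp: x_def dist_norm norm_minus_commute)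
      define G where "G n t = (- (w - s)) ^ n * g n t" for n t
      have G_norm: "norm (G n t) = norm (g n t) * x ^ n" for n t
        by (simp only: G_def x_def norm_mult norm_power norm_minus_cancel mult.commute)
      have G_int: "integrable positive_reals (G n)" for n
        unfolding G_def[abs_def] by (intro integrable_mult_right g_int)
      have ae: "AE t in positive_reals. summable (\<lambda>n. norm (G n t))"
        using series_le x
        by (intro AE_I2 summableI_nonneg_bounded) (auto simp: space_restrict_space G_norm)
      have norms: "summable (\<lambda>n. LINT t|positive_reals. norm (G n t))"
      proof (rule summableI_nonneg_bounded)
        fix N
        have "(\<Sum>n<N. LINT t|positive_reals. norm (G n t)) = (LINT t|positive_reals. (\<Sum>n<N. norm (G n t)))"
          using G_int by (intro Bochner_Integration.integral_sum[symmetric]) auto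
        also have "\<dots> \<le> integral\<^sup>L positive_reals W"
          using G_int W series_le x
          by (intro integral_mono Bochner_Integration.integrable_sum integrable_norm)
             (auto simp: space_restrict_space G_norm)
        finally show "(\<Sum>n<N. LINT t|positive_reals. norm (G n t)) \<le> integral\<^sup>L positive_reals W" .
      qed auto
      have "(\<lambda>n. integral\<^sup>L positive_reals (G n)) sums (LINT t|positive_reals. (\<Sum>n. G n t))"
        by (intro sums_integral G_int ae norms)
      also have "(\<lambda>t. (\<Sum>n. G n t)) = (\<lambda>t. exp (- (w * of_real t)) * complex_of_real (f t))"
      proof
        fix t
        define E where "E = exp (- (s * of_real t)) * complex_of_real (f t)"
        have "(\<lambda>n. (- (w - s) * of_real t) ^ n /\<^sub>R fact n * E) sums (exp (- (w - s) * of_real t) * E)"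
          by (intro sums_mult2 exp_converges)
        also have "(\<lambda>n. (- (w - s) * of_real t) ^ n /\<^sub>R fact n * E) = (\<lambda>n. G n t)"
          unfolding power_mult_distrib
          by (simp add: fun_eq_iff G_def g_def E_def scaleR_conv_of_real divide_inverse mult_ac del: minus_diff_eq)
        also have "exp (- (w - s) * of_real t) * E = exp (- (w * of_real t)) * complex_of_real (f t)"
          unfolding E_def mult.assoc[symmetric] exp_add[symmetric] by (simp add: algebra_simps)
        finally show "(\<Sum>n. G n t) = exp (- (w * of_real t)) * complex_of_real (f t)"
          by (rule sums_unique[symmetric])
      qed
      also have "(LINT t|positive_reals. exp (- (w * of_real t)) * complex_of_real (f t)) = laplace f w"
        by (rule laplace_eq_integral[symmetric])
      also have "(\<lambda>n. integral\<^sup>L positive_reals (G n)) =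
          (\<lambda>n. (-1) ^ n * integral\<^sup>L positive_reals (g n) * (w - s) ^ n)"
      proof
        fix n
        have "integral\<^sup>L positive_reals (G n) = (- (w - s)) ^ n * integral\<^sup>L positive_reals (g n)"
          unfolding G_def[abs_def] by (rule integral_mult_right_zero)
        thus "integral\<^sup>L positive_reals (G n) = (-1) ^ n * integral\<^sup>L positive_reals (g n) * (w - s) ^ n"
          unfolding power_minus[of "w - s"] by (simp only: mult_ac)
      qed
      finally show ?thesis .
    qed
    hence "laplace f analytic_on ball s r" by (rule power_series_analytic)
    thus ?thesis by (rule analytic_on_subset) (use r in auto)
  qed
  hence "laplace f analytic_on {s. Re s0 < Re s}"
    by (subst analytic_on_analytic_at) auto
  thus ?thesis by (rule analytic_imp_holomorphic)
qed

text \<open>Continuity from the right up to the abscissa where the integral is only assumed to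
  converge absolutely; it carries identities from the open half-plane to its boundary.\<close>
lemma laplace_right_limit:
  assumes conv: "laplace_converges f s0"
  shows "(\<lambda>n. laplace f (s0 + of_real (1 / real (Suc n)))) \<longlonglongrightarrow> laplace f s0"
  unfolding laplace_eq_integral
proof (rule integral_dominated_convergence)
  show "integrable positive_reals (\<lambda>t. norm (exp (- (s0 * of_real t)) * complex_of_real (f t)))"
    using conv by (simp add: laplace_converges_iff)
  show "AE t in positive_reals. (\<lambda>n. exp (- ((s0 + of_real (1 / real (Suc n))) * of_real t)) * complex_of_real (f t))
      \<longlonglongrightarrow> exp (- (s0 * of_real t)) * complex_of_real (f t)"
  proof (rule AE_I2)
    fix t
    have "(\<lambda>n. exp (- ((s0 + of_real (1 / real (Suc n))) * of_real t)) * complex_of_real (f t))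
      \<longlonglongrightarrow> exp (- ((s0 + of_real 0) * of_real t)) * complex_of_real (f t)"
      by (intro tendsto_intros LIMSEQ_Suc[OF lim_const_over_n])
    thus "(\<lambda>n. exp (- ((s0 + of_real (1 / real (Suc n))) * of_real t)) * complex_of_real (f t))
      \<longlonglongrightarrow> exp (- (s0 * of_real t)) * complex_of_real (f t)" by simp
  qed
  show "AE t in positive_reals. norm (exp (- ((s0 + of_real (1 / real (Suc n))) * of_real t)) * complex_of_real (f t))
      \<le> norm (exp (- (s0 * of_real t)) * complex_of_real (f t))" for n
  proof (intro AE_I2)
    fix t assume "t \<in> space positive_reals"
    hence t: "t > 0" by (simp add: space_restrict_space)
    have "Re s0 * t \<le> Re (s0 + of_real (1 / real (Suc n))) * t"
      using t by (intro mult_right_mono) auto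
    thus "norm (exp (- ((s0 + of_real (1 / real (Suc n))) * of_real t)) * complex_of_real (f t))
      \<le> norm (exp (- (s0 * of_real t)) * complex_of_real (f t))"
      unfolding norm_mult by (intro mult_right_mono) (simp_all del: of_real_divide plus_complex.sel)
  qed
qed (rule laplace_integrand_borel_measurable[OF conv])+

lemma norm_le_norm_add_of_real:
  assumes "0 \<le> Re s" "0 \<le> u"
  shows "norm s \<le> norm (s + of_real u)"
proof -
  have "(Re s)\<^sup>2 \<le> (Re s + u)\<^sup>2" using assms by (intro power_mono) auto
  thus ?thesis by (simp add: cmod_def)
qed

text \<open>Moving a point of the region to the right never leaves the region, since the real part is
  positive and so the modulus increases as well. Every point is therefore joined by a horizontal ray to the
  convex half-plane \<open>Re s > max c r\<close>, which lies in the region.\<close>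
lemma half_plane_minus_disc_connected:
  assumes "c \<ge> 0"
  shows "connected {s. c < Re s \<and> r < norm s}" (is "connected ?D")
proof -
  define H where "H = {s. Re s > max c r}"
  define ray where "ray s = (\<lambda>u. s + of_real u) ` {0..}" for s :: complex
  have H: "convex H" unfolding H_def by (rule convex_halfspace_Re_gt)
  have HD: "H \<subseteq> ?D"
  proof
    fix s assume "s \<in> H"
    thus "s \<in> ?D" using complex_Re_le_cmod[of s] by (auto simp: H_def)
  qed
  have rayD: "ray s \<subseteq> ?D" if s: "s \<in> ?D" for s
  proof
    fix w assume "w \<in> ray s"
    then obtain u where u: "u \<ge> 0" "w = s + of_real u" by (auto simp: ray_def)
    have "norm s \<le> norm w"
      unfolding u(2) using s assms u(1) by (intro norm_le_norm_add_of_real) auto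
    thus "w \<in> ?D" using u s by auto
  qed
  have conn: "connected (ray s \<union> H)" for s
  proof (rule connected_Un)
    show "connected (ray s)"
      unfolding ray_def by (intro connected_continuous_image continuous_intros) auto
    show "connected H" using H by (rule convex_connected)
    have "s + of_real (\<bar>Re s\<bar> + max c r + 1) \<in> ray s"
      unfolding ray_def using assms by (intro imageI) auto
    moreover have "s + of_real (\<bar>Re s\<bar> + max c r + 1) \<in> H" by (auto simp: H_def)
    ultimately show "ray s \<inter> H \<noteq> {}" by blast
  qed
  have "?D = (\<Union>s\<in>?D. ray s \<union> H)"
  proof
    have "s \<in> ray s" for s unfolding ray_def by (rule image_eqI[of _ _ 0]) auto
    thus "?D \<subseteq> (\<Union>s\<in>?D. ray s \<union> H)" by blast
    show "(\<Union>s\<in>?D. ray s \<union> H) \<subseteq> ?D" using HD rayD by blast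
  qed
  also have "connected \<dots>"
  proof (rule connected_Union)
    have "of_real (max c r + 1) \<in> H" by (auto simp: H_def)
    thus "\<Inter> ((\<lambda>s. ray s \<union> H) ` ?D) \<noteq> {}" by blast
  qed (use conn in auto)
  finally show ?thesis .
qed

text \<open>Identity theorem. On the part of the region that lies to the right of \<open>s0\<close>, which is
  connected, both sides are holomorphic, and they agree on a real ray, hence everywhere on it. The
  point \<open>s0\<close> is on the boundary of this part and is reached as a limit from the right.\<close>
lemma laplace_eq_continuation:
  fixes F :: "complex \<Rightarrow> complex" and r :: real
  defines "D \<equiv> {s. 0 < Re s \<and> r < norm s}"
  assumes F: "F holomorphic_on D"
  assumes real_ray: "\<And>\<sigma>. \<sigma> > 0 \<Longrightarrow> \<sigma> > r \<Longrightarrow> laplace f (of_real \<sigma>) = F (of_real \<sigma>)"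
  assumes s0: "s0 \<in> D" and conv: "laplace_converges f s0"
  shows "laplace f s0 = F s0"
proof -
  define E where "E = {s. Re s0 < Re s \<and> r < norm s}"
  have Re_s0: "Re s0 > 0" using s0 by (simp add: D_def)
  have ED: "E \<subseteq> D" using Re_s0 by (auto simp: E_def D_def)
  have openD: "open D" unfolding D_def
    by (intro open_Collect_conj open_Collect_less continuous_intros)
  have openE: "open E" unfolding E_def
    by (intro open_Collect_conj open_Collect_less continuous_intros)
  have connE: "connected E" unfolding E_def
    by (rule half_plane_minus_disc_connected) (use Re_s0 in auto)
  define m where "m = max (Re s0) r"
  have on_E: "laplace f w - F w = 0" if w: "w \<in> E" for w
  proof (rule analytic_continuation[where f = "\<lambda>s. laplace f s - F s" and S = E and U = "of_real ` {m<..}" and \<xi> = "of_real (m + 1)"])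
    show "(\<lambda>s. laplace f s - F s) holomorphic_on E"
      by (intro holomorphic_intros holomorphic_on_subset[OF laplace_holomorphic[OF conv]]
            holomorphic_on_subset[OF F ED]) (auto simp: E_def)
    have *: "complex_of_real x \<in> E" if "x > m" for x
      using that Re_s0 by (auto simp: E_def m_def)
    show "complex_of_real ` {m<..} \<subseteq> E" "complex_of_real (m + 1) \<in> E" using *[of "m + 1"] * by auto
    have "(m + 1) islimpt {m<..}"
      by (intro interior_limit_point) (auto simp: interior_open)
    hence "\<exists>X. (\<forall>n. X n \<in> {m<..} - {m + 1}) \<and> X \<longlonglongrightarrow> m + 1"
      by (simp add: islimpt_sequential)
    then obtain X where X: "\<And>n. X n \<in> {m<..} - {m + 1}" "X \<longlonglongrightarrow> m + 1" by blast
    show "complex_of_real (m + 1) islimpt of_real ` {m<..}"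
      unfolding islimpt_sequential
      by (rule exI[of _ "\<lambda>n. of_real (X n)"]) (use X in \<open>auto intro!: tendsto_of_real simp del: of_real_add\<close>)
    show "laplace f z - F z = 0" if "z \<in> complex_of_real ` {m<..}" for z
      using that real_ray Re_s0 by (auto simp: m_def)
  qed (use w openE connE in auto)
  have seq_E: "s0 + of_real (1 / real (Suc n)) \<in> E" for n
  proof -
    have "norm s0 \<le> norm (s0 + of_real (1 / real (Suc n)))"
      using Re_s0 by (intro norm_le_norm_add_of_real) auto
    thus ?thesis using s0 by (auto simp: E_def D_def)
  qed
  have "(\<lambda>n. s0 + of_real (1 / real (Suc n))) \<longlonglongrightarrow> s0 + of_real 0"
    by (intro tendsto_intros LIMSEQ_Suc[OF lim_const_over_n])
  hence seq: "(\<lambda>n. s0 + of_real (1 / real (Suc n))) \<longlonglongrightarrow> s0" by (simp only: of_real_0 add_0_right)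
  have "isCont F s0"
    using continuous_on_eq_continuous_at[OF openD, of F] holomorphic_on_imp_continuous_on[OF F] s0 by auto
  hence "(\<lambda>n. F (s0 + of_real (1 / real (Suc n)))) \<longlonglongrightarrow> F s0"
    using seq by (rule isCont_tendsto_compose)
  moreover have "(\<lambda>n. F (s0 + of_real (1 / real (Suc n)))) = (\<lambda>n. laplace f (s0 + of_real (1 / real (Suc n))))"
    using on_E[OF seq_E] by (intro ext) (simp only: right_minus_eq)
  ultimately have "(\<lambda>n. laplace f (s0 + of_real (1 / real (Suc n)))) \<longlonglongrightarrow> F s0" by simp
  with laplace_right_limit[OF conv] show ?thesis by (rule LIMSEQ_unique)
qed

section \<open>The transform of the parameter derivative\<close>

theorem theorem1:
  fixes \<alpha> \<beta> l :: real
    and f :: "real \<Rightarrow> real"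
    and D :: "complex set"
    and F :: "complex \<Rightarrow> complex"
  assumes "\<alpha> > 0" and "\<beta> > 0"
  defines "f \<equiv> (\<lambda>t. deriv (\<lambda>a. t powr (\<beta> - 1) * mittag_leffler a \<beta> (l * t powr a)) \<alpha>)"
    and "D \<equiv> {s. Re s > 0 \<and> norm (of_real l * s powr (- of_real \<alpha>)) < 1}"
    and "F \<equiv> (\<lambda>s. - (of_real l * s powr (of_real \<alpha> - of_real \<beta>) * Ln s)
                    / (s powr (of_real \<alpha>) - of_real l)\<^sup>2)"
  shows
    "(\<forall>t>0. (\<lambda>a. t powr (\<beta> - 1) * mittag_leffler a \<beta> (l * t powr a))
               field_differentiable (at \<alpha>)
          \<and> (\<lambda>k. real k * l ^ k *
               (t powr (\<alpha> * real k + \<beta> - 1) * (ln t - Digamma (\<alpha> * real k + \<beta>))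
                 / Gamma (\<alpha> * real k + \<beta>))) sums f t)
     \<and> (\<forall>s\<in>D. laplace f s =
          (LINT t:{0<..}|lborel. exp (- (s * of_real t)) *
             of_real (\<Sum>k. real k * l ^ k *
               (t powr (\<alpha> * real k + \<beta> - 1) * (ln t - Digamma (\<alpha> * real k + \<beta>))
                 / Gamma (\<alpha> * real k + \<beta>)))))
     \<and> (\<forall>s\<in>D. laplace_converges f s \<longrightarrow> laplace f s = F s)
     \<and> (\<forall>s. \<bar>l\<bar> powr (1 / \<alpha>) < Re s \<longrightarrow> s \<in> D \<and> laplace_converges f s \<and> laplace f s = F s)
     \<and> has_laplace_transform_on f F D"
proof -
  note \<alpha> = \<open>\<alpha> > 0\<close> and \<beta> = \<open>\<beta> > 0\<close>
  define r where "r = \<bar>l\<bar> powr (1 / \<alpha>)"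
  have r: "r \<ge> 0" by (simp add: r_def)
  have r_less_iff: "\<bar>l\<bar> < x powr \<alpha> \<longleftrightarrow> r < x" if "x \<ge> 0" for x
  proof -
    have "r powr \<alpha> = \<bar>l\<bar>" using \<alpha> by (simp add: r_def powr_powr)
    moreover have "r powr \<alpha> < x powr \<alpha>" if "r < x"
      using that \<alpha> r by (intro powr_less_mono2) auto
    moreover have "x powr \<alpha> \<le> r powr \<alpha>" if "x \<le> r"
      using that \<alpha> \<open>x \<ge> 0\<close> by (intro powr_mono2) auto
    ultimately show ?thesis by (cases "r < x") auto
  qed
  \<comment> \<open>Only the modulus of \<open>s\<close> enters the condition, because the exponent is real: the domain
  is the right half-plane without a disc around 0.\<close>
  have D_eq: "D = {s. 0 < Re s \<and> r < norm s}"
  proof -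
    have "norm (of_real l * s powr (- of_real \<alpha>)) < 1 \<longleftrightarrow> r < norm s" if "0 < Re s" for s :: complex
    proof -
      have s: "norm s > 0" using that by auto
      have "norm (of_real l * s powr (- of_real \<alpha>)) = \<bar>l\<bar> / norm s powr \<alpha>"
        using norm_powr_real_powr'[of "- of_real \<alpha>" s] by (simp add: norm_mult powr_minus divide_inverse)
      also have "\<dots> < 1 \<longleftrightarrow> \<bar>l\<bar> < norm s powr \<alpha>" using s by (simp add: pos_divide_less_eq)
      finally show ?thesis using r_less_iff[of "norm s"] by simp
    qed
    thus ?thesis by (auto simp: D_def)
  qed
  define S where "S t = (\<Sum>k. real k * l ^ k * log_kernel (\<alpha> * real k + \<beta>) t)" for t
  have f_eq: "f t = S t" if "t > 0" for t
    unfolding f_def S_def by (intro DERIV_imp_deriv mittag_leffler_has_parameter_derivative \<alpha> \<beta> that)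
  have sums_f: "(\<lambda>k. real k * l ^ k *
               (t powr (\<alpha> * real k + \<beta> - 1) * (ln t - Digamma (\<alpha> * real k + \<beta>))
                 / Gamma (\<alpha> * real k + \<beta>))) sums f t" if "t > 0" for t
    using summable_sums[OF summable_norm_cancel[OF mittag_leffler_has_parameter_derivative(1)[OF \<alpha> \<beta> that]]] f_eq[OF that]
    by (simp add: S_def log_kernel_def)
  have part1: "\<forall>t>0. (\<lambda>a. t powr (\<beta> - 1) * mittag_leffler a \<beta> (l * t powr a))
               field_differentiable (at \<alpha>)
          \<and> (\<lambda>k. real k * l ^ k *
               (t powr (\<alpha> * real k + \<beta> - 1) * (ln t - Digamma (\<alpha> * real k + \<beta>))
                 / Gamma (\<alpha> * real k + \<beta>))) sums f t"
    using sums_f mittag_leffler_has_parameter_derivative(2)[OF \<alpha> \<beta>]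
    unfolding field_differentiable_def by blast
  have part2: "laplace f s =
          (LINT t:{0<..}|lborel. exp (- (s * of_real t)) *
             of_real (\<Sum>k. real k * l ^ k *
               (t powr (\<alpha> * real k + \<beta> - 1) * (ln t - Digamma (\<alpha> * real k + \<beta>))
                 / Gamma (\<alpha> * real k + \<beta>))))" for s
    unfolding laplace_def
    by (rule set_lebesgue_integral_cong) (use sums_f in \<open>auto simp: sums_iff\<close>)
  \<comment> \<open>The formula is computed on the real axis; the rest of the domain is reached by
  continuation.\<close>
  have real_ray: "laplace_converges f (of_real \<sigma>) \<and> laplace f (of_real \<sigma>) = F (of_real \<sigma>)"
    if \<sigma>: "\<sigma> > 0" "\<sigma> > r" for \<sigma>
  proof -
    have l: "\<bar>l\<bar> < \<sigma> powr \<alpha>" using r_less_iff[of \<sigma>] \<sigma> by simp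
    note L = log_kernel_series_laplace[OF \<alpha> \<beta> \<sigma>(1) l mittag_leffler_has_parameter_derivative(1)[OF \<alpha> \<beta>],
        folded S_def]
    have eq: "exp (- (of_real \<sigma> * of_real t)) * complex_of_real (f t) = of_real (S t * exp (- (\<sigma> * t)))"
      if "t \<in> space positive_reals" for t
      using that by (simp add: space_restrict_space f_eq flip: exp_of_real)
    have "integrable positive_reals (\<lambda>t. complex_of_real (S t * exp (- (\<sigma> * t))))"
      using L(1) by (rule integrable_of_real)
    hence "laplace_converges f (of_real \<sigma>)"
      unfolding laplace_converges_iff
      by (subst Bochner_Integration.integrable_cong[OF refl eq])
    moreover have "laplace f (of_real \<sigma>) = (LINT t|positive_reals. complex_of_real (S t * exp (- (\<sigma> * t))))"
      unfolding laplace_eq_integral by (rule Bochner_Integration.integral_cong[OF refl eq])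
    moreover have "\<dots> = of_real (- (l * \<sigma> powr (\<alpha> - \<beta>) * ln \<sigma>) / (\<sigma> powr \<alpha> - l)\<^sup>2)"
      using L(2) by (simp only: integral_complex_of_real)
    moreover have "\<dots> = F (of_real \<sigma>)"
      using \<sigma> by (simp add: F_def powr_of_real Ln_of_real flip: of_real_diff)
    ultimately show ?thesis by simp
  qed
  have F_hol: "F holomorphic_on D"
  proof -
    have "s \<notin> \<real>\<^sub>\<le>\<^sub>0" if "s \<in> D" for s
      using that by (auto simp: D_eq complex_nonpos_Reals_iff)
    moreover have "(s powr (of_real \<alpha>) - of_real l)\<^sup>2 \<noteq> 0" if "s \<in> D" for s
    proof
      assume "(s powr (of_real \<alpha>) - of_real l)\<^sup>2 = 0"
      hence "norm (s powr (of_real \<alpha>)) = \<bar>l\<bar>" by simp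
      moreover have "\<bar>l\<bar> < norm s powr \<alpha>" using that r_less_iff[of "norm s"] by (simp add: D_eq)
      ultimately show False by (simp add: norm_powr_real_powr')
    qed
    ultimately show ?thesis unfolding F_def by (intro holomorphic_intros)
  qed
  have part3: "laplace f s = F s" if "s \<in> D" "laplace_converges f s" for s
    using laplace_eq_continuation[of F r f s] F_hol real_ray that by (simp add: D_eq)
  have part4: "s \<in> D \<and> laplace_converges f s \<and> laplace f s = F s" if s: "r < Re s" for s
  proof -
    have "Re s > 0" using r s by linarith
    moreover have "r < norm s" using s complex_Re_le_cmod[of s] by linarith
    ultimately have sD: "s \<in> D" by (simp add: D_eq)
    have "laplace_converges f s"
      by (rule laplace_converges_mono[of f "of_real (Re s)"]) (use real_ray \<open>Re s > 0\<close> s in auto)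
    thus ?thesis using sD part3 by blast
  qed
  have "has_laplace_transform_on f F D"
    unfolding has_laplace_transform_on_def
  proof (intro conjI)
    show "open D" unfolding D_eq
      by (intro open_Collect_conj open_Collect_less continuous_intros)
    show "connected D" unfolding D_eq by (rule half_plane_minus_disc_connected) simp
    show "\<exists>c. \<forall>s. c < Re s \<longrightarrow> s \<in> D \<and> laplace_converges f s" using part4 by blast
  qed (use F_hol part3 in auto)
  thus ?thesis using part1 part2 part3 part4 unfolding r_def by blast
qed

end
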